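(* Let $R$ be a complete local domain of mixed characteristic $p$ with $F$-finite residue field. Then $\tau_{\mathrm{wepf}}(R)=0$.
   Context: All rings (other than $R^+$) are commutative Noetherian. Mixed characteristic $p$ means $R$ has characteristic $0$ and its residue field has characteristic $p>0$. For a domain $R$, the absolute integral closure $R^+$ is the integral closure of $R$ in an algebraic closure of its fraction field. Full extended plus closure (epf): for $R$-modules $N\subseteq M$, $N_M^{\mathrm{epf}}$ is the set of $u\in M$ for which there exists a nonzero $c\in R$ such that for all positive integers $n$, $$c^{1/n}\otimes u\in \operatorname{im}\left(R^+\otimes_R N+R^+\otimes_R p^nM\to R^+\otimes_R M\right),$$ where $c^{1/n}\in R^+$ denotes an $n$-th root of $c$, and the image is the sum of the images of $R^+\otimes_R N$ and $R^+\otimes_R p^nM$ in $R^+\otimes_R M$. Weak full extended plus closure (wepf): $N_M^{\mathrm{wepf}}:=\bigcap_{n\geq 0}(N+p^nM)_M^{\mathrm{epf}}$. The (big) test ideal of a closure operation $\mathrm{cl}$ is $\tau_{\mathrm{cl}}(R)=\bigcap_{N\subseteq M} (N:_R N_M^{\mathrm{cl}})$, the intersection being over all pairs of $R$-modules $N\subseteq M$ (not necessarily finitely generated). *)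

theory Defs
  imports "HOL-Algebra.Algebra"
begin

section \<open>Complete local rings of mixed characteristic\<close>

definition local_ring :: "('a, 'r) ring_scheme \<Rightarrow> bool" where
  "local_ring R \<longleftrightarrow> cring R \<and> (\<exists>!m. maximalideal m R)"

definition max_ideal :: "('a, 'r) ring_scheme \<Rightarrow> 'a set" where
  "max_ideal R = (THE m. maximalideal m R)"

definition residue_field :: "('a, 'r) ring_scheme \<Rightarrow> 'a set ring" where
  "residue_field R = R Quot max_ideal R"

text \<open>
  Completeness includes separatedness: together the two conditions say that
  \<open>R\<close> maps bijectively to the inverse limit of the rings \<open>R/I^n\<close>.
\<close>

definition adically_complete :: "('a, 'r) ring_scheme \<Rightarrow> 'a set \<Rightarrow> bool" where
  "adically_complete R I \<longleftrightarrow>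
     (\<Inter>n::nat. I [^]\<^bsub>ideals_set R\<^esub> n) = {\<zero>\<^bsub>R\<^esub>} \<and>
     (\<forall>x :: nat \<Rightarrow> 'a. (\<forall>n. x n \<in> carrier R) \<longrightarrow>
        (\<forall>n. x (Suc n) \<ominus>\<^bsub>R\<^esub> x n \<in> I [^]\<^bsub>ideals_set R\<^esub> n) \<longrightarrow>
        (\<exists>y \<in> carrier R. \<forall>n. y \<ominus>\<^bsub>R\<^esub> x n \<in> I [^]\<^bsub>ideals_set R\<^esub> n))"

definition complete_local_domain :: "('a, 'r) ring_scheme \<Rightarrow> bool" where
  "complete_local_domain R \<longleftrightarrow>
     noetherian_domain R \<and> local_ring R \<and> adically_complete R (max_ideal R)"

definition ring_char :: "('a, 'r) ring_scheme \<Rightarrow> nat" where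
  "ring_char R =
     (if \<exists>n::nat. n > 0 \<and> [n] \<cdot>\<^bsub>R\<^esub> \<one>\<^bsub>R\<^esub> = \<zero>\<^bsub>R\<^esub>
      then LEAST n::nat. n > 0 \<and> [n] \<cdot>\<^bsub>R\<^esub> \<one>\<^bsub>R\<^esub> = \<zero>\<^bsub>R\<^esub> else 0)"

definition mixed_characteristic :: "('a, 'r) ring_scheme \<Rightarrow> nat \<Rightarrow> bool" where
  "mixed_characteristic R p \<longleftrightarrow>
     ring_char R = 0 \<and> ring_char (residue_field R) = p \<and> p > 0"

text \<open>
  A ring \<open>k\<close> of characteristic \<open>p\<close> is \<open>F\<close>-finite if it is finitely generated as a
  module over itself via the Frobenius endomorphism.
\<close>

definition F_finite :: "nat \<Rightarrow> ('a, 'r) ring_scheme \<Rightarrow> bool" where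
  "F_finite p k \<longleftrightarrow>
     (\<exists>A. finite A \<and> A \<subseteq> carrier k \<and>
        (\<forall>x \<in> carrier k. \<exists>c \<in> A \<rightarrow> carrier k.
           x = (\<Oplus>\<^bsub>k\<^esub>a\<in>A. (c a [^]\<^bsub>k\<^esub> p) \<otimes>\<^bsub>k\<^esub> a)))"


section \<open>The absolute integral closure\<close>

definition fraction_field_in ::
    "('a, 'r) ring_scheme \<Rightarrow> ('k, 'l) ring_scheme \<Rightarrow> ('a \<Rightarrow> 'k) \<Rightarrow> 'k set" where
  "fraction_field_in R L \<phi> =
     {\<phi> a \<otimes>\<^bsub>L\<^esub> inv\<^bsub>L\<^esub> (\<phi> b) | a b. a \<in> carrier R \<and> b \<in> carrier R - {\<zero>\<^bsub>R\<^esub>}}"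

text \<open>
  \<open>L\<close> is an algebraic closure of the fraction field of \<open>R\<close>, by means of the embedding
  \<open>\<phi>\<close>. Algebraic closures are unique only up to isomorphism, so \<open>L\<close> and \<open>\<phi>\<close> are kept as
  parameters of everything that follows.
\<close>

definition algebraic_closure_of_fractions ::
    "('a, 'r) ring_scheme \<Rightarrow> ('k, 'l) ring_scheme \<Rightarrow> ('a \<Rightarrow> 'k) \<Rightarrow> bool" where
  "algebraic_closure_of_fractions R L \<phi> \<longleftrightarrow>
     \<phi> \<in> ring_hom R L \<and> inj_on \<phi> (carrier R) \<and>
     algebraic_closure L (fraction_field_in R L \<phi>)"

definition integral_over :: "('k, 'l) ring_scheme \<Rightarrow> 'k set \<Rightarrow> 'k \<Rightarrow> bool" where
  "integral_over L A x \<longleftrightarrow>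
     (\<exists>q. q \<noteq> [] \<and> set q \<subseteq> A \<and> lead_coeff q = \<one>\<^bsub>L\<^esub> \<and> ring.eval L q x = \<zero>\<^bsub>L\<^esub>)"

definition absolute_integral_closure ::
    "('a, 'r) ring_scheme \<Rightarrow> ('k, 'l) ring_scheme \<Rightarrow> ('a \<Rightarrow> 'k) \<Rightarrow> ('k, 'l) ring_scheme" where
  "absolute_integral_closure R L \<phi> =
     L\<lparr>carrier := {x \<in> carrier L. integral_over L (\<phi> ` carrier R) x}\<rparr>"


section \<open>Tensor products\<close>

text \<open>
  For an \<open>R\<close>-algebra \<open>S\<close> with structure map \<open>\<phi>\<close> and an \<open>R\<close>-module \<open>M\<close>, the underlying
  abelian group of the tensor product of \<open>S\<close> and \<open>M\<close> over \<open>R\<close> is the free abelian group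
  on the pairs \<open>(s, x)\<close> modulo the bilinearity and balancing relations. As usual for
  \<open>free_Abelian_group\<close>, the group is written multiplicatively.
\<close>

definition tensor_relators ::
    "('a, 'r) ring_scheme \<Rightarrow> ('k, 'l) ring_scheme \<Rightarrow> ('a \<Rightarrow> 'k) \<Rightarrow> ('a, 'm) module
      \<Rightarrow> ('k \<times> 'm \<Rightarrow>\<^sub>0 int) set" where
  "tensor_relators R S \<phi> M =
     {frag_of (s \<oplus>\<^bsub>S\<^esub> t, x) - frag_of (s, x) - frag_of (t, x) | s t x.
        s \<in> carrier S \<and> t \<in> carrier S \<and> x \<in> carrier M} \<union>
     {frag_of (s, x \<oplus>\<^bsub>M\<^esub> y) - frag_of (s, x) - frag_of (s, y) | s x y.
        s \<in> carrier S \<and> x \<in> carrier M \<and> y \<in> carrier M} \<union>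
     {frag_of (\<phi> r \<otimes>\<^bsub>S\<^esub> s, x) - frag_of (s, r \<odot>\<^bsub>M\<^esub> x) | r s x.
        r \<in> carrier R \<and> s \<in> carrier S \<and> x \<in> carrier M}"

definition tensor_relations ::
    "('a, 'r) ring_scheme \<Rightarrow> ('k, 'l) ring_scheme \<Rightarrow> ('a \<Rightarrow> 'k) \<Rightarrow> ('a, 'm) module
      \<Rightarrow> ('k \<times> 'm \<Rightarrow>\<^sub>0 int) set" where
  "tensor_relations R S \<phi> M =
     generate (free_Abelian_group (carrier S \<times> carrier M)) (tensor_relators R S \<phi> M)"

definition tensor_product ::
    "('a, 'r) ring_scheme \<Rightarrow> ('k, 'l) ring_scheme \<Rightarrow> ('a \<Rightarrow> 'k) \<Rightarrow> ('a, 'm) module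
      \<Rightarrow> ('k \<times> 'm \<Rightarrow>\<^sub>0 int) set monoid" where
  "tensor_product R S \<phi> M =
     free_Abelian_group (carrier S \<times> carrier M) Mod tensor_relations R S \<phi> M"

definition elementary_tensor ::
    "('a, 'r) ring_scheme \<Rightarrow> ('k, 'l) ring_scheme \<Rightarrow> ('a \<Rightarrow> 'k) \<Rightarrow> ('a, 'm) module
      \<Rightarrow> 'k \<Rightarrow> 'm \<Rightarrow> ('k \<times> 'm \<Rightarrow>\<^sub>0 int) set" where
  "elementary_tensor R S \<phi> M s x =
     tensor_relations R S \<phi> M #>\<^bsub>free_Abelian_group (carrier S \<times> carrier M)\<^esub> frag_of (s, x)"

definition restrict_module :: "('a, 'm) module \<Rightarrow> 'm set \<Rightarrow> ('a, 'm) module" where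
  "restrict_module M N = M\<lparr>carrier := N\<rparr>"

text \<open>
  The map from \<open>S \<otimes> N\<close> to \<open>S \<otimes> M\<close> induced by the inclusion of a submodule \<open>N\<close> of \<open>M\<close>:
  it enlarges a coset of the relations for \<open>N\<close> to the coset of the relations for \<open>M\<close>
  with the same representative. It is in general not injective.
\<close>

definition tensor_inclusion ::
    "('a, 'r) ring_scheme \<Rightarrow> ('k, 'l) ring_scheme \<Rightarrow> ('a \<Rightarrow> 'k) \<Rightarrow> ('a, 'm) module
      \<Rightarrow> ('k \<times> 'm \<Rightarrow>\<^sub>0 int) set \<Rightarrow> ('k \<times> 'm \<Rightarrow>\<^sub>0 int) set" where
  "tensor_inclusion R S \<phi> M T =
     tensor_relations R S \<phi> M <#>\<^bsub>free_Abelian_group (carrier S \<times> carrier M)\<^esub> T"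

definition tensor_image ::
    "('a, 'r) ring_scheme \<Rightarrow> ('k, 'l) ring_scheme \<Rightarrow> ('a \<Rightarrow> 'k) \<Rightarrow> ('a, 'm) module
      \<Rightarrow> 'm set \<Rightarrow> ('k \<times> 'm \<Rightarrow>\<^sub>0 int) set set" where
  "tensor_image R S \<phi> M N =
     tensor_inclusion R S \<phi> M ` carrier (tensor_product R S \<phi> (restrict_module M N))"


section \<open>Extended plus closures and test ideals\<close>

definition nat_multiples :: "('a, 'm) module \<Rightarrow> nat \<Rightarrow> 'm set" where
  "nat_multiples M k = {[k] \<cdot>\<^bsub>M\<^esub> x | x. x \<in> carrier M}"

text \<open>
  The choice of the \<open>n\<close>-th root \<open>d\<close> of \<open>c\<close> is immaterial: two choices differ by a root of
  unity, which is a unit of the absolute integral closure.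
\<close>

definition epf ::
    "nat \<Rightarrow> ('a, 'r) ring_scheme \<Rightarrow> ('k, 'l) ring_scheme \<Rightarrow> ('a \<Rightarrow> 'k)
      \<Rightarrow> ('a, 'm) module \<Rightarrow> 'm set \<Rightarrow> 'm set" where
  "epf p R L \<phi> M N =
     (let S = absolute_integral_closure R L \<phi> in
      {u \<in> carrier M. \<exists>c \<in> carrier R - {\<zero>\<^bsub>R\<^esub>}. \<forall>n::nat. n > 0 \<longrightarrow>
         (\<exists>d \<in> carrier S. d [^]\<^bsub>S\<^esub> n = \<phi> c \<and>
            elementary_tensor R S \<phi> M d u \<in>
              tensor_image R S \<phi> M N <#>\<^bsub>tensor_product R S \<phi> M\<^esub>
              tensor_image R S \<phi> M (nat_multiples M (p ^ n)))})"

definition wepf ::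
    "nat \<Rightarrow> ('a, 'r) ring_scheme \<Rightarrow> ('k, 'l) ring_scheme \<Rightarrow> ('a \<Rightarrow> 'k)
      \<Rightarrow> ('a, 'm) module \<Rightarrow> 'm set \<Rightarrow> 'm set" where
  "wepf p R L \<phi> M N = (\<Inter>n::nat. epf p R L \<phi> M (N <+>\<^bsub>M\<^esub> nat_multiples M (p ^ n)))"

definition module_colon ::
    "('a, 'r) ring_scheme \<Rightarrow> ('a, 'm) module \<Rightarrow> 'm set \<Rightarrow> 'm set \<Rightarrow> 'a set" where
  "module_colon R M N K = {r \<in> carrier R. \<forall>x \<in> K. r \<odot>\<^bsub>M\<^esub> x \<in> N}"

text \<open>
  A closure operation sends a module \<open>M\<close> and a submodule \<open>N\<close> to a subset of \<open>M\<close>. HOL cannot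
  quantify over types inside a formula, so the intersection is over all \<open>R\<close>-modules, finitely
  generated or not, whose carrier is a set of elements of \<open>'m\<close>.

  For an infinite domain \<open>R\<close> and the closure \<open>wepf\<close>, this is the intersection over all
  \<open>R\<close>-modules as soon as \<open>carrier R\<close> injects into \<open>'m\<close>. Indeed, if \<open>u\<close> is in
  \<open>wepf p R L \<phi> M N\<close>, this is witnessed by countably many elements of \<open>M\<close>, and then \<open>u\<close> is in
  \<open>wepf p R L \<phi> M' (N \<inter> M')\<close> for a countably generated submodule \<open>M'\<close> of \<open>M\<close>, with
  \<open>r \<odot> u \<in> N\<close> equivalent to \<open>r \<odot> u \<in> N \<inter> M'\<close>. A countably generated \<open>R\<close>-module has at most
  as many elements as \<open>R\<close>, hence is isomorphic to one with carrier in \<open>'m\<close>.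
\<close>

definition test_ideal ::
    "('a, 'r) ring_scheme \<Rightarrow> (('a, 'm) module \<Rightarrow> 'm set \<Rightarrow> 'm set) \<Rightarrow> 'a set" where
  "test_ideal R cl =
     {r \<in> carrier R. \<forall>M N. module R M \<and> submodule N R M \<longrightarrow> r \<in> module_colon R M N (cl M N)}"

end

theory Submission
  imports Defs
begin

text \<open>
  If multiplication by \<open>p\<close> is surjective on \<open>M\<close>, then \<open>N + p^n M = M\<close> for all \<open>n\<close>, so the
  \<open>wepf\<close> closure of every submodule \<open>N\<close> is \<open>M\<close>. In mixed characteristic this applies to
  \<open>N = 0\<close> in the fraction field of \<open>R\<close>, which no nonzero element of \<open>R\<close> annihilates. The
  fraction field has at most as many elements as the infinite ring \<open>R\<close>, so it has a copy
  with carrier in \<open>'m\<close>.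
\<close>

section \<open>Natural multiples, sums of submodules and characteristic zero\<close>

lemma (in module) add_pow_eq_smult:
  assumes "x \<in> carrier M"
  shows "[k] \<cdot>\<^bsub>M\<^esub> x = ([(k::nat)] \<cdot>\<^bsub>R\<^esub> \<one>) \<odot>\<^bsub>M\<^esub> x"
proof (induction k)
  case 0
  then show ?case using assms by simp
next
  case (Suc k)
  then show ?case using assms by (simp add: smult_l_distr)
qed

lemma (in module) zero_submodule: "submodule {\<zero>\<^bsub>M\<^esub>} R M"
  by (rule submoduleI) auto

lemma (in abelian_group) set_add_carrier:
  assumes "N \<subseteq> carrier G" and "\<zero> \<in> N"
  shows "N <+> carrier G = carrier G"
proof
  show "N <+> carrier G \<subseteq> carrier G"
    using assms by (auto simp: set_add_def')
  show "carrier G \<subseteq> N <+> carrier G"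
  proof
    fix x assume x: "x \<in> carrier G"
    then have "x = \<zero> \<oplus> x" by simp
    with x assms(2) show "x \<in> N <+> carrier G"
      unfolding set_add_def' by blast
  qed
qed

lemma ring_char_eq_0D:
  assumes "ring_char R = 0" and "n > 0"
  shows "[(n::nat)] \<cdot>\<^bsub>R\<^esub> \<one>\<^bsub>R\<^esub> \<noteq> \<zero>\<^bsub>R\<^esub>"
proof
  assume *: "[n] \<cdot>\<^bsub>R\<^esub> \<one>\<^bsub>R\<^esub> = \<zero>\<^bsub>R\<^esub>"
  let ?P = "\<lambda>n::nat. n > 0 \<and> [n] \<cdot>\<^bsub>R\<^esub> \<one>\<^bsub>R\<^esub> = \<zero>\<^bsub>R\<^esub>"
  \<comment> \<open>The least such number is positive, whereas \<open>ring_char\<close> takes the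
    value 0 only as the default when there is none.\<close>
  have "?P (LEAST n. ?P n)"
    by (rule LeastI[of ?P n]) (use assms * in auto)
  moreover have "\<exists>n. ?P n" using assms(2) * by blast
  then have "ring_char R = (LEAST n. ?P n)"
    by (simp only: ring_char_def if_True)
  ultimately show False using assms(1) by auto
qed

text \<open>The multiples of \<one> are pairwise distinct, since a coincidence would make the
  positive multiple \<open>n - m\<close> of \<one> vanish. Infinitude makes \<open>R\<close> as
  large as its set of pairs.\<close>

lemma (in ring) infinite_carrier_if_char_0:
  assumes "ring_char R = 0"
  shows "infinite (carrier R)"
proof -
  let ?f = "\<lambda>n::nat. [n] \<cdot> \<one>"
  have neq: "?f m \<noteq> ?f n" if "m < n" for m n
  proof
    assume eq: "?f m = ?f n"
    have "?f m \<oplus> ?f (n - m) = ?f n"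
      using that add.nat_pow_mult[of \<one> m "n - m"] by simp
    with eq have "?f m \<oplus> ?f (n - m) = ?f m \<oplus> \<zero>" by simp
    then have "?f (n - m) = \<zero>" by (metis add.l_cancel add.nat_pow_closed one_closed zero_closed)
    with ring_char_eq_0D[OF assms, of "n - m"] that show False by simp
  qed
  then have "inj ?f"
    by (metis injI linorder_neqE_nat)
  moreover have "range ?f \<subseteq> carrier R" by auto
  ultimately show ?thesis
    by (meson finite_subset range_inj_infinite)
qed


section \<open>The closure in divisible modules\<close>

text \<open>
  Nothing below needs the absolute integral closure to be a ring. Without this, the
  relators are not known to lie in the free abelian group, so its subgroup lemmas do not apply.
\<close>

lemma tensor_relations_set_mult_idem:
  "tensor_relations R S \<phi> M <#>\<^bsub>free_Abelian_group (carrier S \<times> carrier M)\<^esub> tensor_relations R S \<phi> M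
     = tensor_relations R S \<phi> M" 
proof
  let ?G = "free_Abelian_group (carrier S \<times> carrier M)"
  let ?H = "tensor_relations R S \<phi> M"
  \<comment> \<open>The rule \<open>generate.eng\<close> gives closure under the operation for any
    set of generators.\<close>
  show "?H <#>\<^bsub>?G\<^esub> ?H \<subseteq> ?H"
    unfolding set_mult_def tensor_relations_def using generate.eng by fastforce
  have one: "\<one>\<^bsub>?G\<^esub> \<in> ?H"
    unfolding tensor_relations_def by (rule generate.one)
  show "?H \<subseteq> ?H <#>\<^bsub>?G\<^esub> ?H"
  proof
    fix x assume "x \<in> ?H"
    moreover have "x = \<one>\<^bsub>?G\<^esub> \<otimes>\<^bsub>?G\<^esub> x" by (simp add: free_Abelian_group_def)
    ultimately show "x \<in> ?H <#>\<^bsub>?G\<^esub> ?H"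
      unfolding set_mult_def using one by blast
  qed
qed

text \<open>The operation of a free abelian group is the addition of the whole type of finitely
  supported functions, so associativity is available for arbitrary sets.\<close>

lemma set_mult_r_coset_free_Abelian_group:
  "H <#>\<^bsub>free_Abelian_group A\<^esub> (K #>\<^bsub>free_Abelian_group A\<^esub> f)
     = (H <#>\<^bsub>free_Abelian_group A\<^esub> K) #>\<^bsub>free_Abelian_group A\<^esub> f"
  by (auto simp: set_mult_def r_coset_def free_Abelian_group_def add.assoc)

text \<open>Adding the relations to a coset of the relations changes nothing, so
  \<open>tensor_inclusion\<close> fixes every coset and the image of the full module is the whole
  tensor product.\<close>

lemma coset_in_tensor_image_carrier:
  assumes "f \<in> carrier (free_Abelian_group (carrier S \<times> carrier M))"
  shows "tensor_relations R S \<phi> M #>\<^bsub>free_Abelian_group (carrier S \<times> carrier M)\<^esub> f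
           \<in> tensor_image R S \<phi> M (carrier M)"
proof -
  let ?G = "free_Abelian_group (carrier S \<times> carrier M)"
  let ?H = "tensor_relations R S \<phi> M"
  have "?H #>\<^bsub>?G\<^esub> f \<in> carrier (tensor_product R S \<phi> M)"
    using assms by (auto simp: tensor_product_def FactGroup_def RCOSETS_def)
  moreover have "tensor_inclusion R S \<phi> M (?H #>\<^bsub>?G\<^esub> f) = ?H #>\<^bsub>?G\<^esub> f"
    by (simp add: tensor_inclusion_def set_mult_r_coset_free_Abelian_group
        tensor_relations_set_mult_idem)
  ultimately show ?thesis
    \<comment> \<open>Restricting \<open>M\<close> to its own carrier gives back \<open>M\<close>,
      so the coset serves as its own preimage.\<close>
    by (simp add: tensor_image_def restrict_module_def) (rule image_eqI[OF sym])
qed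

text \<open>Write the tensor as zero plus itself, both summands lying in the full image. This is the
  membership that \<open>epf\<close> demands once both the submodule and the
  \<open>p ^ n\<close>-multiples are all of \<open>M\<close>.\<close>

lemma elementary_tensor_in_tensor_image_carrier:
  assumes "s \<in> carrier S" and "x \<in> carrier M"
  shows "elementary_tensor R S \<phi> M s x \<in>
           tensor_image R S \<phi> M (carrier M) <#>\<^bsub>tensor_product R S \<phi> M\<^esub>
           tensor_image R S \<phi> M (carrier M)"
proof -
  let ?G = "free_Abelian_group (carrier S \<times> carrier M)"
  let ?H = "tensor_relations R S \<phi> M"
  have "?H #>\<^bsub>?G\<^esub> 0 \<in> tensor_image R S \<phi> M (carrier M)"
    by (rule coset_in_tensor_image_carrier) (simp add: free_Abelian_group_def)
  moreover have "?H #>\<^bsub>?G\<^esub> frag_of (s, x) \<in> tensor_image R S \<phi> M (carrier M)"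
    by (rule coset_in_tensor_image_carrier) (use assms in \<open>simp add: free_Abelian_group_def\<close>)
  moreover have "?H #>\<^bsub>?G\<^esub> 0 = ?H"
    by (auto simp: r_coset_def free_Abelian_group_def)
  then have "elementary_tensor R S \<phi> M s x
      = (?H #>\<^bsub>?G\<^esub> 0) \<otimes>\<^bsub>tensor_product R S \<phi> M\<^esub> (?H #>\<^bsub>?G\<^esub> frag_of (s, x))"
    by (simp add: elementary_tensor_def tensor_product_def FactGroup_def
        set_mult_r_coset_free_Abelian_group tensor_relations_set_mult_idem)
  ultimately show ?thesis
    unfolding set_mult_def by blast
qed

lemma one_in_absolute_integral_closure:
  assumes "ring R" and "ring L" and "\<phi> \<in> ring_hom R L"
  shows "\<one>\<^bsub>L\<^esub> \<in> carrier (absolute_integral_closure R L \<phi>)"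
proof -
  interpret R: ring R by fact
  interpret L: ring L by fact
  interpret h: ring_hom_ring R L \<phi> by (rule ring_hom_ringI2) fact+
  \<comment> \<open>The polynomial \<open>X - 1\<close>, with coefficients listed from the highest
    degree down.\<close>
  let ?q = "[\<one>\<^bsub>L\<^esub>, \<ominus>\<^bsub>L\<^esub> \<one>\<^bsub>L\<^esub>]"
  have "set ?q \<subseteq> \<phi> ` carrier R"
    using imageI[OF R.one_closed, of \<phi>] imageI[OF R.a_inv_closed[OF R.one_closed], of \<phi>] by simp
  moreover have "L.eval ?q \<one>\<^bsub>L\<^esub> = \<zero>\<^bsub>L\<^esub>" by (simp add: L.r_neg)
  ultimately have "integral_over L (\<phi> ` carrier R) \<one>\<^bsub>L\<^esub>"
    unfolding integral_over_def by (intro exI[of _ ?q]) simp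
  then show ?thesis by (simp add: absolute_integral_closure_def)
qed

text \<open>Divisibility enters twice: it enlarges \<open>N\<close> to \<open>M\<close> in
  \<open>wepf\<close>, and it makes the \<open>p ^ n\<close>-multiples in \<open>epf\<close> all of
  \<open>M\<close>. The constant \<open>c = 1\<close>, with every root equal to 1, then works for
  each element.\<close>

lemma wepf_eq_carrier_if_divisible:
  assumes "ring R" and "\<one>\<^bsub>R\<^esub> \<noteq> \<zero>\<^bsub>R\<^esub>" and "ring L" and \<phi>: "\<phi> \<in> ring_hom R L"
    and "module R M" and "submodule N R M"
    and div: "\<And>n. nat_multiples M (p ^ n) = carrier M"
  shows "wepf p R L \<phi> M N = carrier M"
proof -
  interpret R: ring R by fact
  interpret L: ring L by fact
  interpret M: module R M by fact
  let ?S = "absolute_integral_closure R L \<phi>"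
  have one: "\<one>\<^bsub>L\<^esub> \<in> carrier ?S"
    using assms by (intro one_in_absolute_integral_closure)
  \<comment> \<open>The multiplication and unit of \<open>?S\<close> are those of \<open>L\<close>,
    so the power is computed there.\<close>
  have pow: "\<one>\<^bsub>L\<^esub> [^]\<^bsub>?S\<^esub> n = \<phi> \<one>\<^bsub>R\<^esub>" for n :: nat
    using ring_hom_one[OF \<phi>]
    by (induction n) (simp_all add: absolute_integral_closure_def)
  have "\<zero>\<^bsub>M\<^esub> \<in> N"
    using submodule.axioms(1)[OF \<open>submodule N R M\<close>] subgroup.one_closed by fastforce
  then have "N <+>\<^bsub>M\<^esub> carrier M = carrier M"
    using M.submoduleE(1)[OF \<open>submodule N R M\<close>] by (rule M.set_add_carrier[rotated])
  moreover have "epf p R L \<phi> M (carrier M) = carrier M"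
  proof -
    have "\<one>\<^bsub>R\<^esub> \<in> carrier R - {\<zero>\<^bsub>R\<^esub>}" using \<open>\<one>\<^bsub>R\<^esub> \<noteq> \<zero>\<^bsub>R\<^esub>\<close> by simp
    moreover have "elementary_tensor R ?S \<phi> M \<one>\<^bsub>L\<^esub> u \<in>
        tensor_image R ?S \<phi> M (carrier M) <#>\<^bsub>tensor_product R ?S \<phi> M\<^esub>
        tensor_image R ?S \<phi> M (nat_multiples M (p ^ n))" if "u \<in> carrier M" for u n
      unfolding div using one that by (rule elementary_tensor_in_tensor_image_carrier)
    ultimately show ?thesis
      unfolding epf_def Let_def using one pow by fastforce
  qed
  ultimately show ?thesis
    unfolding wepf_def div by simp
qed


section \<open>A copy of the fraction field\<close>

text \<open>Transport of structure along \<open>j\<close>, meant to be injective on the carrier. It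
  moves a module into the type \<open>'m\<close>, to which \<open>test_ideal\<close> confines its
  modules.\<close>

definition transported_module ::
    "('a, 'n, 'x) module_scheme \<Rightarrow> ('n \<Rightarrow> 'm) \<Rightarrow> ('a, 'm) module" where
  "transported_module M j = (let g = inv_into (carrier M) j in
     \<lparr>carrier = j ` carrier M, monoid.mult = (\<lambda>x y. j (g x \<otimes>\<^bsub>M\<^esub> g y)), monoid.one = j \<one>\<^bsub>M\<^esub>,
      ring.zero = j \<zero>\<^bsub>M\<^esub>, add = (\<lambda>x y. j (g x \<oplus>\<^bsub>M\<^esub> g y)), smult = (\<lambda>r x. j (r \<odot>\<^bsub>M\<^esub> g x))\<rparr>)"

lemma module_transported_module:
  assumes "module R M" and "inj_on j (carrier M)"
  shows "module R (transported_module M j)"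
proof -
  interpret M: module R M by fact
  \<comment> \<open>With this cancellation every operation on images under \<open>j\<close> becomes
    \<open>j\<close> of the operation in \<open>M\<close>, which reduces each axiom to that of
    \<open>M\<close>.\<close>
  have [simp]: "inv_into (carrier M) j (j x) = x" if "x \<in> carrier M" for x
    using assms(2) that by simp
  define T where "T = transported_module M j"
  have [simp]: "carrier T = j ` carrier M" "\<zero>\<^bsub>T\<^esub> = j \<zero>\<^bsub>M\<^esub>"
    by (simp_all add: T_def transported_module_def Let_def)
  have [simp]: "j x \<oplus>\<^bsub>T\<^esub> j y = j (x \<oplus>\<^bsub>M\<^esub> y)" if "x \<in> carrier M" "y \<in> carrier M" for x y
    using that by (simp add: T_def transported_module_def Let_def)
  have [simp]: "r \<odot>\<^bsub>T\<^esub> j x = j (r \<odot>\<^bsub>M\<^esub> x)" if "x \<in> carrier M" for r x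
    using that by (simp add: T_def transported_module_def Let_def)
  have "abelian_group T"
  proof (rule abelian_groupI)
    fix x assume "x \<in> carrier T"
    then obtain a where a: "a \<in> carrier M" "x = j a" by auto
    then have "j (\<ominus>\<^bsub>M\<^esub> a) \<oplus>\<^bsub>T\<^esub> x = \<zero>\<^bsub>T\<^esub>" by (simp add: M.l_neg)
    with a show "\<exists>y\<in>carrier T. y \<oplus>\<^bsub>T\<^esub> x = \<zero>\<^bsub>T\<^esub>"
      by (metis M.a_inv_closed \<open>carrier T = j ` carrier M\<close> imageI)
  qed (auto simp: M.a_ac)
  then have "module R T"
    by (intro moduleI)
      (auto simp: M.is_cring M.smult_l_distr M.smult_r_distr M.smult_assoc1)
  then show ?thesis by (simp add: T_def)
qed

definition restrict_scalars ::
    "('k, 'l) ring_scheme \<Rightarrow> ('a \<Rightarrow> 'k) \<Rightarrow> 'k set \<Rightarrow> ('a, 'k) module" where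
  "restrict_scalars L \<phi> F =
     \<lparr>carrier = F, monoid.mult = (\<otimes>\<^bsub>L\<^esub>), monoid.one = \<one>\<^bsub>L\<^esub>, ring.zero = \<zero>\<^bsub>L\<^esub>, add = (\<oplus>\<^bsub>L\<^esub>),
      smult = (\<lambda>r x. \<phi> r \<otimes>\<^bsub>L\<^esub> x)\<rparr>"

lemma module_restrict_scalars:
  assumes "cring R" and "ring L" and \<phi>: "\<phi> \<in> ring_hom R L"
    and "subring F L" and "\<phi> ` carrier R \<subseteq> F"
  shows "module R (restrict_scalars L \<phi> F)"
proof -
  interpret R: cring R by fact
  interpret L: ring L by fact
  note F = subringE[OF \<open>subring F L\<close>]
  have F': "x \<in> carrier L" if "x \<in> F" for x using F(1) that by blast
  have \<phi>F: "\<phi> r \<in> F" if "r \<in> carrier R" for r using assms(5) that by blast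
  show ?thesis
  proof (rule moduleI)
    show "abelian_group (restrict_scalars L \<phi> F)"
    proof (rule abelian_groupI)
      fix x assume "x \<in> carrier (restrict_scalars L \<phi> F)"
      then show "\<exists>y\<in>carrier (restrict_scalars L \<phi> F).
          y \<oplus>\<^bsub>restrict_scalars L \<phi> F\<^esub> x = \<zero>\<^bsub>restrict_scalars L \<phi> F\<^esub>"
        using F F' by (auto simp: restrict_scalars_def L.l_neg intro!: bexI[of _ "\<ominus>\<^bsub>L\<^esub> x"])
    qed (use F F' in \<open>auto simp: restrict_scalars_def L.a_ac\<close>)
  qed (use F F' \<phi>F ring_hom_mult[OF \<phi>] ring_hom_add[OF \<phi>] ring_hom_one[OF \<phi>] in
      \<open>auto simp: restrict_scalars_def L.l_distr L.r_distr L.m_assoc R.is_cring\<close>)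
qed

text \<open>Fractions are covered by pairs of elements of \<open>R\<close>, and an infinite set is
  equinumerous with its square. Pairs with zero denominator only enlarge the cover.\<close>

lemma exists_inj_fraction_field_in:
  assumes "infinite (carrier R)"
  shows "\<exists>f. inj_on f (fraction_field_in R L \<phi>) \<and> f ` fraction_field_in R L \<phi> \<subseteq> carrier R"
proof -
  let ?R = "carrier R"
  have "fraction_field_in R L \<phi> \<subseteq> (\<lambda>(a, b). \<phi> a \<otimes>\<^bsub>L\<^esub> inv\<^bsub>L\<^esub> (\<phi> b)) ` (?R \<times> ?R)"
    by (auto simp: fraction_field_in_def)
  then have "|fraction_field_in R L \<phi>| \<le>o |?R \<times> ?R|"
    using surj_imp_ordLeq by blast
  also have "|?R \<times> ?R| =o |?R|"
    using assms by (rule card_of_Times_same_infinite)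
  finally show ?thesis by (simp add: card_of_ordLeq)
qed

section \<open>The test ideal of \<open>wepf\<close>\<close>

theorem corollary3p4:
  fixes R :: "('a, 'r) ring_scheme"
    and L :: "('k, 'l) ring_scheme"
    and \<phi> :: "'a \<Rightarrow> 'k"
    and \<iota> :: "'a \<Rightarrow> 'm"
    and p :: nat
  assumes "complete_local_domain R"
    and "mixed_characteristic R p"
    and "F_finite p (residue_field R)"
    and "algebraic_closure_of_fractions R L \<phi>"
    and "inj_on \<iota> (carrier R)"
  shows "test_ideal R (wepf p R L \<phi> :: ('a, 'm) module \<Rightarrow> 'm set \<Rightarrow> 'm set) = {\<zero>\<^bsub>R\<^esub>}"
proof -
  define F where "F = fraction_field_in R L \<phi>"
  interpret noetherian_domain R
    using assms(1) by (simp add: complete_local_domain_def)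
  have char: "ring_char R = 0" and "p > 0"
    using assms(2) by (simp_all add: mixed_characteristic_def)
  have \<phi>: "\<phi> \<in> ring_hom R L" and inj: "inj_on \<phi> (carrier R)"
    and closure: "algebraic_closure L F"
    using assms(4) by (simp_all add: algebraic_closure_of_fractions_def F_def)
  interpret L: algebraic_closure L F by (rule closure)
  interpret h: ring_hom_ring R L \<phi> by (rule ring_hom_ringI2[OF ring_axioms L.ring_axioms \<phi>])
  \<comment> \<open>The locale \<open>algebraic_closure\<close> has \<open>F\<close> as a subfield
    of \<open>L\<close>, so closure of the fractions under the operations comes with it.\<close>
  have subF: "subring F L" by (rule L.subring_axioms)
  have \<phi>_Units: "\<phi> r \<in> Units L" if "r \<in> carrier R" "r \<noteq> \<zero>\<^bsub>R\<^esub>" for r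
    using that inj inj_onD[OF inj, of r "\<zero>\<^bsub>R\<^esub>"] by (auto simp: L.field_Units)
  have mult_inv_cancel: "a \<otimes>\<^bsub>L\<^esub> (inv\<^bsub>L\<^esub> a \<otimes>\<^bsub>L\<^esub> x) = x"
    if "a \<in> Units L" "x \<in> carrier L" for a x
    using that by (simp add: L.m_assoc[symmetric] L.Units_closed)
  have fraction_F: "\<phi> a \<otimes>\<^bsub>L\<^esub> inv\<^bsub>L\<^esub> (\<phi> b) \<in> F"
    if "a \<in> carrier R" "b \<in> carrier R" "b \<noteq> \<zero>\<^bsub>R\<^esub>" for a b
    using that unfolding F_def fraction_field_in_def by blast
  have inv_F: "inv\<^bsub>L\<^esub> (\<phi> r) \<in> F" if "r \<in> carrier R" "r \<noteq> \<zero>\<^bsub>R\<^esub>" for r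
    using fraction_F[OF one_closed that] L.Units_inv_closed[OF \<phi>_Units[OF that]] by simp
  have \<phi>_F: "\<phi> r \<in> F" if "r \<in> carrier R" for r
    using fraction_F[OF that one_closed one_not_zero] that by simp
  obtain f where f: "inj_on f F" "f ` F \<subseteq> carrier R"
    using exists_inj_fraction_field_in[OF infinite_carrier_if_char_0[OF char], of L \<phi>]
    unfolding F_def by blast
  \<comment> \<open>The fraction field is embedded in \<open>'m\<close> by way of \<open>R\<close>:
    first \<open>f\<close> into \<open>carrier R\<close>, then \<iota>.\<close>
  define j where "j = \<iota> \<circ> f"
  have j: "inj_on j F"
    unfolding j_def using f assms(5) by (blast intro: comp_inj_on inj_on_subset)
  define M where "M = transported_module (restrict_scalars L \<phi> F) j"
  have "module R (restrict_scalars L \<phi> F)"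
    using is_cring L.ring_axioms \<phi> subF \<phi>_F by (intro module_restrict_scalars) auto
  then have "module R M"
    unfolding M_def by (rule module_transported_module) (simp add: restrict_scalars_def j)
  then interpret M: module R M .
  have carr: "carrier M = j ` F" and zero: "\<zero>\<^bsub>M\<^esub> = j \<zero>\<^bsub>L\<^esub>"
    by (simp_all add: M_def transported_module_def restrict_scalars_def Let_def)
  have smult: "r \<odot>\<^bsub>M\<^esub> j x = j (\<phi> r \<otimes>\<^bsub>L\<^esub> x)" if "x \<in> F" for r x
    using that j by (simp add: M_def transported_module_def restrict_scalars_def Let_def)
  have "nat_multiples M (p ^ n) = carrier M" for n
  proof
    \<comment> \<open>The integer \<open>p ^ n\<close> as an element of \<open>R\<close>. It is
      nonzero in characteristic 0, so its image in \<open>F\<close> can be inverted.\<close>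
    let ?k = "[(p ^ n)] \<cdot>\<^bsub>R\<^esub> \<one>\<^bsub>R\<^esub>"
    have k: "?k \<in> carrier R" "?k \<noteq> \<zero>\<^bsub>R\<^esub>"
      using ring_char_eq_0D[OF char, of "p ^ n"] \<open>p > 0\<close> by simp_all
    show "nat_multiples M (p ^ n) \<subseteq> carrier M"
      by (auto simp: nat_multiples_def)
    show "carrier M \<subseteq> nat_multiples M (p ^ n)"
    proof
      fix y assume "y \<in> carrier M"
      then obtain x where x: "x \<in> F" "y = j x" unfolding carr by blast
      \<comment> \<open>Dividing \<open>x\<close> by \<open>p ^ n\<close> inside \<open>F\<close>
        yields the element whose multiple is \<open>x\<close>.\<close>
      let ?x = "inv\<^bsub>L\<^esub> (\<phi> ?k) \<otimes>\<^bsub>L\<^esub> x"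
      have x': "?x \<in> F" using inv_F[OF k] x(1) subringE(6)[OF subF] by blast
      have "[(p ^ n)] \<cdot>\<^bsub>M\<^esub> j ?x = ?k \<odot>\<^bsub>M\<^esub> j ?x"
        by (rule M.add_pow_eq_smult) (use x' carr in blast)
      also have "\<dots> = j (\<phi> ?k \<otimes>\<^bsub>L\<^esub> ?x)" by (rule smult[OF x'])
      also have "\<phi> ?k \<otimes>\<^bsub>L\<^esub> ?x = x"
        using x(1) subringE(1)[OF subF] by (intro mult_inv_cancel \<phi>_Units[OF k]) blast
      finally have "[(p ^ n)] \<cdot>\<^bsub>M\<^esub> j ?x = y" using x(2) by simp
      then show "y \<in> nat_multiples M (p ^ n)"
        unfolding nat_multiples_def using x' carr by blast
    qed
  qed
  then have wepf: "wepf p R L \<phi> M {\<zero>\<^bsub>M\<^esub>} = carrier M"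
    by (intro wepf_eq_carrier_if_divisible[OF ring_axioms one_not_zero L.ring_axioms \<phi>
          \<open>module R M\<close> M.zero_submodule])
  show ?thesis
  proof
    show "test_ideal R (wepf p R L \<phi> :: ('a, 'm) module \<Rightarrow> 'm set \<Rightarrow> 'm set) \<subseteq> {\<zero>\<^bsub>R\<^esub>}"
    proof
      fix r assume r: "r \<in> test_ideal R (wepf p R L \<phi> :: ('a, 'm) module \<Rightarrow> _)"
      then have "r \<in> carrier R" and "r \<in> module_colon R M {\<zero>\<^bsub>M\<^esub>} (wepf p R L \<phi> M {\<zero>\<^bsub>M\<^esub>})"
        using \<open>module R M\<close> M.zero_submodule unfolding test_ideal_def by blast+
      then have "\<forall>x\<in>carrier M. r \<odot>\<^bsub>M\<^esub> x = \<zero>\<^bsub>M\<^esub>"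
        unfolding wepf by (simp add: module_colon_def)
      \<comment> \<open>The element 1 of the fraction field already detects \<open>r\<close>: its
        multiple by \<open>r\<close> is the copy of \<open>\<phi> r\<close>, and \<phi> and
        \<open>j\<close> are injective.\<close>
      then have "r \<odot>\<^bsub>M\<^esub> j \<one>\<^bsub>L\<^esub> = j \<zero>\<^bsub>L\<^esub>"
        using subringE(3)[OF subF] by (simp add: carr zero)
      then have "j (\<phi> r) = j \<zero>\<^bsub>L\<^esub>"
        using smult[OF subringE(3)[OF subF], of r] \<open>r \<in> carrier R\<close> by simp
      then have "\<phi> r = \<phi> \<zero>\<^bsub>R\<^esub>"
        using inj_onD[OF j] \<phi>_F[OF \<open>r \<in> carrier R\<close>] subringE(2)[OF subF] by simp
      then show "r \<in> {\<zero>\<^bsub>R\<^esub>}"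
        using inj_onD[OF inj] \<open>r \<in> carrier R\<close> by simp
    qed
    \<comment> \<open>For the reverse inclusion, the closure lies in the module, so 0 sends each of
      its elements to zero, which every submodule contains.\<close>
    have "\<zero>\<^bsub>R\<^esub> \<odot>\<^bsub>M'\<^esub> x \<in> N"
      if "module R M'" "submodule N R M'" "x \<in> wepf p R L \<phi> M' N" for M' :: "('a, 'm) module" and N x
    proof -
      interpret M': module R M' by fact
      have "x \<in> carrier M'"
        using that(3) by (auto simp: wepf_def epf_def Let_def)
      moreover have "\<zero>\<^bsub>M'\<^esub> \<in> N"
        using submodule.axioms(1)[OF that(2)] subgroup.one_closed by fastforce
      ultimately show ?thesis by simp
    qed
    then show "{\<zero>\<^bsub>R\<^esub>} \<subseteq> test_ideal R (wepf p R L \<phi> :: ('a, 'm) module \<Rightarrow> 'm set \<Rightarrow> 'm set)"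
      by (auto simp: test_ideal_def module_colon_def)
  qed
qed

end
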